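(* There exists an infinite family of $4$-regular planar graphs each of which admits a bendless planar smooth orthogonal drawing but admits no bendless planar octilinear drawing.
   Context: All drawings are planar: vertices are distinct points in the plane and edges are drawn without crossings. In a smooth orthogonal drawing every edge is a sequence of segments, each of which is either an axis-aligned straight-line segment or a circular arc (quarter, half or three-quarter arc) whose tangents at its endpoints are axis-aligned, with consecutive segments sharing a common tangent; each edge leaves/enters a vertex in one of the four axis-aligned directions (ports), and no two edges incident to a vertex use the same port. In an octilinear drawing every edge is a sequence of straight-line segments, each horizontal, vertical, or of slope $\pm 1$; each vertex has eight ports (the eight corresponding directions), and no two edges incident to a vertex use the same port. A drawing is bendless if every edge consists of exactly one segment. *)

theory Defs
  imports "HOL-Complex_Analysis.Complex_Analysis"
begin

record 'v graph =
  verts :: "'v set"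
  edges :: "'v set set"

definition simple_graph :: "'v graph \<Rightarrow> bool" where
  "simple_graph G \<longleftrightarrow>
     finite (verts G) \<and> (\<forall>e\<in>edges G. e \<subseteq> verts G \<and> card e = 2)"

definition regular_graph :: "nat \<Rightarrow> 'v graph \<Rightarrow> bool" where
  "regular_graph k G \<longleftrightarrow> (\<forall>v\<in>verts G. card {e \<in> edges G. v \<in> e} = k)"

definition isomorphic :: "'v graph \<Rightarrow> 'w graph \<Rightarrow> bool" where
  "isomorphic G H \<longleftrightarrow>
     (\<exists>f. bij_betw f (verts G) (verts H) \<and> edges H = (\<lambda>e. f ` e) ` edges G)"

text \<open>The plane is the complex plane. In a drawing, \<open>pos v\<close> is the point representing the vertex
  \<open>v\<close> and \<open>\<gamma> e\<close> a simple curve representing the edge \<open>e\<close>, traversed in one of its two directions.\<close>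

definition planar_drawing ::
    "'v graph \<Rightarrow> ('v \<Rightarrow> complex) \<Rightarrow> ('v set \<Rightarrow> real \<Rightarrow> complex) \<Rightarrow> bool" where
  "planar_drawing G pos \<gamma> \<longleftrightarrow>
     inj_on pos (verts G) \<and>
     (\<forall>e\<in>edges G. arc (\<gamma> e) \<and>
        (\<exists>u v. e = {u, v} \<and> pathstart (\<gamma> e) = pos u \<and> pathfinish (\<gamma> e) = pos v)) \<and>
     (\<forall>e\<in>edges G. \<forall>v\<in>verts G. pos v \<in> path_image (\<gamma> e) \<longrightarrow> v \<in> e) \<and>
     (\<forall>e\<in>edges G. \<forall>e'\<in>edges G. e \<noteq> e' \<longrightarrow>
        path_image (\<gamma> e) \<inter> path_image (\<gamma> e') = pos ` (e \<inter> e'))"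

definition planar_graph :: "'v graph \<Rightarrow> bool" where
  "planar_graph G \<longleftrightarrow> (\<exists>pos \<gamma>. planar_drawing G pos \<gamma>)"

text \<open>Unit tangent vectors, in the direction of traversal, at the two ends of a segment.\<close>

definition start_dir :: "(real \<Rightarrow> complex) \<Rightarrow> complex" where
  "start_dir g = sgn (vector_derivative g (at 0 within {0..1}))"

definition end_dir :: "(real \<Rightarrow> complex) \<Rightarrow> complex" where
  "end_dir g = sgn (vector_derivative g (at 1 within {0..1}))"

definition axis_dirs :: "complex set" where
  "axis_dirs = {1, \<i>, -1, -\<i>}"

definition axis_line_segment :: "(real \<Rightarrow> complex) \<Rightarrow> bool" where
  "axis_line_segment g \<longleftrightarrow>
     (\<exists>a b. a \<noteq> b \<and> (Re a = Re b \<or> Im a = Im b) \<and> g = linepath a b)"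

text \<open>Quarter, half and three-quarter circular arcs, traversed in either orientation.\<close>

definition axis_circular_segment :: "(real \<Rightarrow> complex) \<Rightarrow> bool" where
  "axis_circular_segment g \<longleftrightarrow>
     (\<exists>c r s t. r > 0 \<and> \<bar>t - s\<bar> \<in> {pi / 2, pi, 3 * pi / 2} \<and> g = part_circlepath c r s t) \<and>
     start_dir g \<in> axis_dirs \<and> end_dir g \<in> axis_dirs"

definition octilinear_segment :: "(real \<Rightarrow> complex) \<Rightarrow> bool" where
  "octilinear_segment g \<longleftrightarrow>
     (\<exists>a b. a \<noteq> b \<and>
        (Re a = Re b \<or> Im a = Im b \<or> \<bar>Re b - Re a\<bar> = \<bar>Im b - Im a\<bar>) \<and>
        g = linepath a b)"

text \<open>Only meaningful for nonempty lists.\<close>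

fun join_segments :: "(real \<Rightarrow> complex) list \<Rightarrow> real \<Rightarrow> complex" where
  "join_segments [] = linepath 0 0"
| "join_segments [g] = g"
| "join_segments (g # h # gs) = g +++ join_segments (h # gs)"

definition smooth_orthogonal_edge :: "(real \<Rightarrow> complex) list \<Rightarrow> bool" where
  "smooth_orthogonal_edge gs \<longleftrightarrow>
     gs \<noteq> [] \<and> (\<forall>g\<in>set gs. axis_line_segment g \<or> axis_circular_segment g) \<and>
     successively (\<lambda>g h. pathfinish g = pathstart h \<and> end_dir g = start_dir h) gs"

definition octilinear_edge :: "(real \<Rightarrow> complex) list \<Rightarrow> bool" where
  "octilinear_edge gs \<longleftrightarrow>
     gs \<noteq> [] \<and> (\<forall>g\<in>set gs. octilinear_segment g) \<and>
     successively (\<lambda>g h. pathfinish g = pathstart h) gs"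

text \<open>The direction in which an edge with segments \<open>gs\<close> leaves its end point \<open>p\<close>. For the edges
  considered here it is automatically one of the four, respectively eight, admissible
  directions.\<close>

definition port :: "(real \<Rightarrow> complex) list \<Rightarrow> complex \<Rightarrow> complex" where
  "port gs p = (if pathstart (hd gs) = p then start_dir (hd gs) else - end_dir (last gs))"

definition distinct_ports ::
    "'v graph \<Rightarrow> ('v \<Rightarrow> complex) \<Rightarrow> ('v set \<Rightarrow> (real \<Rightarrow> complex) list) \<Rightarrow> bool" where
  "distinct_ports G pos segs \<longleftrightarrow>
     (\<forall>v\<in>verts G. inj_on (\<lambda>e. port (segs e) (pos v)) {e \<in> edges G. v \<in> e})"

definition planar_smooth_orthogonal_drawing ::
    "'v graph \<Rightarrow> ('v \<Rightarrow> complex) \<Rightarrow> ('v set \<Rightarrow> (real \<Rightarrow> complex) list) \<Rightarrow> bool" where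
  "planar_smooth_orthogonal_drawing G pos segs \<longleftrightarrow>
     planar_drawing G pos (\<lambda>e. join_segments (segs e)) \<and>
     (\<forall>e\<in>edges G. smooth_orthogonal_edge (segs e)) \<and>
     distinct_ports G pos segs"

definition planar_octilinear_drawing ::
    "'v graph \<Rightarrow> ('v \<Rightarrow> complex) \<Rightarrow> ('v set \<Rightarrow> (real \<Rightarrow> complex) list) \<Rightarrow> bool" where
  "planar_octilinear_drawing G pos segs \<longleftrightarrow>
     planar_drawing G pos (\<lambda>e. join_segments (segs e)) \<and>
     (\<forall>e\<in>edges G. octilinear_edge (segs e)) \<and>
     distinct_ports G pos segs"

definition bendless :: "'v graph \<Rightarrow> ('v set \<Rightarrow> (real \<Rightarrow> complex) list) \<Rightarrow> bool" where
  "bendless G segs \<longleftrightarrow> (\<forall>e\<in>edges G. length (segs e) = 1)"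

end

theory Submission
  imports Defs
begin

text \<open>
  The graphs are disjoint unions of square antiprisms.

  Consider a component of a bendless octilinear drawing of a 4-regular graph and a linear functional
  that vanishes on none of the eight directions. It is negative on exactly four of them, so a vertex
  maximising it uses precisely these four ports. The eight sectors of functionals give eight
  different sets of ports, hence eight different vertices. If the component has no further vertices,
  then following one of the four slopes matches the two chains of four vertices on either side of
  the octagon in order, and all edges join vertices of different parity in the cyclic order: the
  component is bipartite. The antiprism has eight vertices and contains a triangle.

  The smooth orthogonal drawing of the antiprism consists of a unit square and four further unit
  segments, six quarter arcs on the unit circles around two opposite corners of the square, and two
  three-quarter arcs of radius 2.
\<close>

section \<open>Octilinear drawings\<close>

definition octilinear_vector :: "complex \<Rightarrow> bool" where
  "octilinear_vector z \<longleftrightarrow> z \<noteq> 0 \<and> (Re z = 0 \<or> Im z = 0 \<or> \<bar>Re z\<bar> = \<bar>Im z\<bar>)"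

text \<open>On octilinear vectors this is the direction, scaled to max-norm 1, so that all eight
  directions have coordinates in {-1, 0, 1} and no square root of 2 enters.\<close>

definition signs :: "complex \<Rightarrow> real \<times> real" where
  "signs z = (sgn (Re z), sgn (Im z))"

definition sign_pairs :: "(real \<times> real) set" where
  "sign_pairs = {(1,0), (1,1), (0,1), (-1,1), (-1,0), (-1,-1), (0,-1), (1,-1)}"

lemma octilinear_vector_eq_scaleR_signs:
  assumes "octilinear_vector z"
  obtains m where "m > 0" "z = m *\<^sub>R Complex (fst (signs z)) (snd (signs z))"
proof
  show "max \<bar>Re z\<bar> \<bar>Im z\<bar> > 0"
    using assms by (auto simp: octilinear_vector_def complex_eq_iff)
  show "z = max \<bar>Re z\<bar> \<bar>Im z\<bar> *\<^sub>R Complex (fst (signs z)) (snd (signs z))"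
    using assms by (auto simp: octilinear_vector_def signs_def complex_eq_iff sgn_if max_def)
qed

lemma signs_in_sign_pairs:
  assumes "octilinear_vector z"
  shows "signs z \<in> sign_pairs"
  using assms
  by (auto simp: octilinear_vector_def signs_def sign_pairs_def complex_eq_iff sgn_if)

text \<open>Both vectors are positive multiples of the same sign vector. Ports are unit vectors;
  this allows counting them by sign pairs.\<close>

lemma sgn_eq_if_signs_eq:
  assumes "octilinear_vector z" "octilinear_vector w" "signs z = signs w"
  shows "sgn z = sgn w"
proof -
  obtain m where m: "m > 0" "z = m *\<^sub>R Complex (fst (signs z)) (snd (signs z))"
    using octilinear_vector_eq_scaleR_signs[OF assms(1)] .
  obtain k where k: "k > 0" "w = k *\<^sub>R Complex (fst (signs w)) (snd (signs w))"
    using octilinear_vector_eq_scaleR_signs[OF assms(2)] .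
  have "sgn z = sgn (Complex (fst (signs z)) (snd (signs z)))"
    using m by (metis scaleR_one sgn_pos sgn_scaleR)
  moreover have "sgn w = sgn (Complex (fst (signs w)) (snd (signs w)))"
    using k by (metis scaleR_one sgn_pos sgn_scaleR)
  ultimately show ?thesis using assms(3) by simp
qed

section \<open>Extreme vertices and bipartiteness\<close>

text \<open>The four distinct \<open>a\<close> values fill a set of four, and two decreasing
  enumerations of one set agree entry by entry.\<close>

lemma four_chain_match:
  fixes a0 a1 a2 a3 b0 b1 b2 b3 :: real
  assumes "a0 > a1" "a1 > a2" "a2 > a3" "b0 > b1" "b1 > b2" "b2 > b3"
    and "a0 \<in> {b0,b1,b2,b3}" "a1 \<in> {b0,b1,b2,b3}" "a2 \<in> {b0,b1,b2,b3}" "a3 \<in> {b0,b1,b2,b3}"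
  shows "a0 = b0 \<and> a1 = b1 \<and> a2 = b2 \<and> a3 = b3"
  using assms unfolding insert_iff empty_iff by (smt (verit))

text \<open>No edge at a maximiser of the functional (a, b) increases it, and genericity rules out a
  constant value, so all ports there lie in \<open>S\<close>. Four distinct ports and
  \<open>card S \<le> 4\<close> force equality. Maximality is returned as well, because it locates
  the maximisers relative to each other.\<close>

lemma extreme_vertex_ports:
  fixes p :: "'v \<Rightarrow> complex" and N :: "'v \<Rightarrow> 'v set" and a b :: real
  assumes fin: "finite H" and ne: "H \<noteq> {}"
    and N: "\<And>v. v \<in> H \<Longrightarrow> N v \<subseteq> H"
    and oct: "\<And>v w. v \<in> H \<Longrightarrow> w \<in> N v \<Longrightarrow> octilinear_vector (p w - p v)"
    and four: "\<And>v. v \<in> H \<Longrightarrow> card ((\<lambda>w. sgn (p w - p v)) ` N v) = 4"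
    and generic: "\<And>s. s \<in> sign_pairs \<Longrightarrow> a * fst s + b * snd s \<noteq> 0"
    and S: "S = {s \<in> sign_pairs. a * fst s + b * snd s < 0}" "card S \<le> 4"
  obtains v where "v \<in> H"
   
    "\<And>w. w \<in> H \<Longrightarrow> a * Re (p w) + b * Im (p w) \<le> a * Re (p v) + b * Im (p v)"
    "(\<lambda>w. signs (p w - p v)) ` N v = S"
proof -
  define f where "f v = a * Re (p v) + b * Im (p v)" for v
  have "Max (f ` H) \<in> f ` H" using fin ne by (intro Max_in) auto
  then obtain v where "v \<in> H" "f v = Max (f ` H)" by auto
  with fin have v: "v \<in> H"
    "\<And>w. w \<in> H \<Longrightarrow> f w \<le> f v" by auto
  let ?T = "(\<lambda>w. signs (p w - p v)) ` N v"
  have finN: "finite (N v)" using N[OF v(1)] fin finite_subset by blast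
  have finS: "finite S" by (simp add: S(1) sign_pairs_def)
  have "?T \<subseteq> S"
  proof (rule image_subsetI)
    fix w assume w: "w \<in> N v"
    obtain m where m: "m > 0"
      "p w - p v = m *\<^sub>R Complex (fst (signs (p w - p v))) (snd (signs (p w - p v)))"
      using octilinear_vector_eq_scaleR_signs[OF oct[OF v(1) w]] .
    define s where "s = signs (p w - p v)"
    have "f w - f v = a * Re (p w - p v) + b * Im (p w - p v)"
      by (simp add: f_def algebra_simps)
    also have "\<dots> = m * (a * fst s + b * snd s)"
      using m(2) by (simp add: s_def[symmetric] complex_eq_iff algebra_simps)
    finally have "m * (a * fst s + b * snd s) \<le> 0" using v(2)[of w] N[OF v(1)] w by auto
    then have "a * fst s + b * snd s \<le> 0" using m(1) by (simp add: mult_le_0_iff)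
    moreover have "s \<in> sign_pairs"
      unfolding s_def using signs_in_sign_pairs oct[OF v(1) w] by blast
    ultimately show "signs (p w - p v) \<in> S" using generic[of s] unfolding S(1) s_def[symmetric] by auto
  qed
  moreover have "4 \<le> card ?T"
  proof -
    \<comment> \<open>\<open>sgn\<close> factors through \<open>signs\<close>: one chosen neighbour
      per sign pair already yields every unit vector, so there are at least as many sign pairs as
      unit vectors.\<close>
    have "(\<lambda>w. sgn (p w - p v)) ` N v \<subseteq>
      (\<lambda>s. sgn (p (SOME w. w \<in> N v \<and> signs (p w - p v) = s) - p v)) ` ?T"
    proof (rule image_subsetI)
      fix w assume w: "w \<in> N v"
      let ?w = "SOME u. u \<in> N v \<and> signs (p u - p v) = signs (p w - p v)"
      have u: "?w \<in> N v \<and> signs (p ?w - p v) = signs (p w - p v)"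
        by (rule someI[of _ w]) (use w in simp)
      have "sgn (p w - p v) = sgn (p ?w - p v)"
        by (rule sgn_eq_if_signs_eq) (use u w oct v(1) in auto)
      then show "sgn (p w - p v) \<in> (\<lambda>s. sgn (p (SOME w. w \<in> N v \<and> signs (p w - p v) = s) - p v)) ` ?T"
        using w by blast
    qed
    then have "card ((\<lambda>w. sgn (p w - p v)) ` N v) \<le> card ?T"
      using finN by (meson card_image_le card_mono finite_imageI order_trans)
    then show ?thesis using four[OF v(1)] by simp
  qed
  ultimately have "?T = S" using S(2) finS by (metis card_seteq order_trans)
  with v show thesis by (intro that) (auto simp: f_def)
qed

text \<open>The colour classes are the two parities of the index in the cyclic order
  \<open>v0\<close>, ..., \<open>v7\<close> of the extreme vertices.\<close>

lemma small_octilinear_component_bipartite: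
  fixes p :: "'v \<Rightarrow> complex" and N :: "'v \<Rightarrow> 'v set"
  assumes fin: "finite H" and ne: "H \<noteq> {}" and card8: "card H \<le> 8" and inj: "inj_on p H"
    and N: "\<And>v. v \<in> H \<Longrightarrow> N v \<subseteq> H"
    and oct: "\<And>v w. v \<in> H \<Longrightarrow> w \<in> N v \<Longrightarrow> octilinear_vector (p w - p v)"
    and four: "\<And>v. v \<in> H \<Longrightarrow> card ((\<lambda>w. sgn (p w - p v)) ` N v) = 4"
  shows "\<exists>C. \<forall>v\<in>H. \<forall>w\<in>N v. v \<in> C \<longleftrightarrow> w \<notin> C"
proof -
  define \<sigma> where "\<sigma> v = (\<lambda>w. signs (p w - p v)) ` N v" for v
  note ext = extreme_vertex_ports[OF fin ne N oct four, folded \<sigma>_def]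
  \<comment> \<open>The functionals (2,1), (1,2), (-1,2), ... run counterclockwise, one in each open
    sector between neighbouring directions. Each set lists the directions on which the functional is
    negative.\<close>
  obtain v0 where v0: "v0 \<in> H"
    "\<And>w. w \<in> H \<Longrightarrow> 2 * Re (p w) + 1 * Im (p w) \<le> 2 * Re (p v0) + 1 * Im (p v0)"
    "\<sigma> v0 = {(-1,1), (-1,0), (-1,-1), (0,-1)}"
    by (rule ext[of "2" "1" "{(-1,1), (-1,0), (-1,-1), (0,-1)}"]) (auto simp: sign_pairs_def)
  obtain v1 where v1: "v1 \<in> H"
    "\<And>w. w \<in> H \<Longrightarrow> 1 * Re (p w) + 2 * Im (p w) \<le> 1 * Re (p v1) + 2 * Im (p v1)"
    "\<sigma> v1 = {(-1,0), (-1,-1), (0,-1), (1,-1)}"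
    by (rule ext[of "1" "2" "{(-1,0), (-1,-1), (0,-1), (1,-1)}"]) (auto simp: sign_pairs_def)
  obtain v2 where v2: "v2 \<in> H"
    "\<And>w. w \<in> H \<Longrightarrow> -1 * Re (p w) + 2 * Im (p w) \<le> -1 * Re (p v2) + 2 * Im (p v2)"
    "\<sigma> v2 = {(-1,-1), (0,-1), (1,-1), (1,0)}"
    by (rule ext[of "-1" "2" "{(-1,-1), (0,-1), (1,-1), (1,0)}"]) (auto simp: sign_pairs_def)
  obtain v3 where v3: "v3 \<in> H"
    "\<And>w. w \<in> H \<Longrightarrow> -2 * Re (p w) + 1 * Im (p w) \<le> -2 * Re (p v3) + 1 * Im (p v3)"
    "\<sigma> v3 = {(0,-1), (1,-1), (1,0), (1,1)}"
    by (rule ext[of "-2" "1" "{(0,-1), (1,-1), (1,0), (1,1)}"]) (auto simp: sign_pairs_def)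
  obtain v4 where v4: "v4 \<in> H"
    "\<And>w. w \<in> H \<Longrightarrow> -2 * Re (p w) + -1 * Im (p w) \<le> -2 * Re (p v4) + -1 * Im (p v4)"
    "\<sigma> v4 = {(1,-1), (1,0), (1,1), (0,1)}"
    by (rule ext[of "-2" "-1" "{(1,-1), (1,0), (1,1), (0,1)}"]) (auto simp: sign_pairs_def)
  obtain v5 where v5: "v5 \<in> H"
    "\<And>w. w \<in> H \<Longrightarrow> -1 * Re (p w) + -2 * Im (p w) \<le> -1 * Re (p v5) + -2 * Im (p v5)"
    "\<sigma> v5 = {(1,0), (1,1), (0,1), (-1,1)}"
    by (rule ext[of "-1" "-2" "{(1,0), (1,1), (0,1), (-1,1)}"]) (auto simp: sign_pairs_def)
  obtain v6 where v6: "v6 \<in> H"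
    "\<And>w. w \<in> H \<Longrightarrow> 1 * Re (p w) + -2 * Im (p w) \<le> 1 * Re (p v6) + -2 * Im (p v6)"
    "\<sigma> v6 = {(1,1), (0,1), (-1,1), (-1,0)}"
    by (rule ext[of "1" "-2" "{(1,1), (0,1), (-1,1), (-1,0)}"]) (auto simp: sign_pairs_def)
  obtain v7 where v7: "v7 \<in> H"
    "\<And>w. w \<in> H \<Longrightarrow> 2 * Re (p w) + -1 * Im (p w) \<le> 2 * Re (p v7) + -1 * Im (p v7)"
    "\<sigma> v7 = {(0,1), (-1,1), (-1,0), (-1,-1)}"
    by (rule ext[of "2" "-1" "{(0,1), (-1,1), (-1,0), (-1,-1)}"]) (auto simp: sign_pairs_def)
  let ?V = "[v0,v1,v2,v3,v4,v5,v6,v7]"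
  \<comment> \<open>The sums are the eight pairs with one entry of absolute value 3 and the other of
    absolute value 1: a numerical invariant of the port set that separates the vertices.\<close>
  define h where "h v = (\<Sum>s\<in>\<sigma> v. s)" for v
  have "distinct (map h ?V)"
    by (simp add: h_def v0(3) v1(3) v2(3) v3(3) v4(3) v5(3) v6(3) v7(3))
  then have dist: "distinct ?V" by (simp only: distinct_map)
  have H: "H = {v0,v1,v2,v3,v4,v5,v6,v7}"
  proof -
    have "card (set ?V) = 8" using distinct_card[OF dist] by simp
    then show ?thesis
      using card_seteq[OF fin, of "set ?V"] card8 v0(1) v1(1) v2(1) v3(1) v4(1) v5(1) v6(1) v7(1) by auto
  qed
  have nbr: "\<exists>w\<in>H. \<exists>t>0. Re (p w) = Re (p v) + fst s * t \<and> Im (p w) = Im (p v) + snd s * t"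
    if "s \<in> \<sigma> v" "v \<in> H" for v s
  proof -
    obtain w where w: "w \<in> N v" "s = signs (p w - p v)" using \<open>s \<in> \<sigma> v\<close> unfolding \<sigma>_def by blast
    obtain t where "t > 0" "p w - p v = t *\<^sub>R Complex (fst s) (snd s)"
      using octilinear_vector_eq_scaleR_signs[OF oct[OF \<open>v \<in> H\<close> w(1)]] w(2) by metis
    then have "t > 0 \<and> Re (p w) = Re (p v) + fst s * t \<and> Im (p w) = Im (p v) + snd s * t"
      by (auto simp: complex_eq_iff algebra_simps)
    then show ?thesis using w(1) N[OF \<open>v \<in> H\<close>] by blast
  qed
  define X where "X v = Re (p v)" for v
  define Y where "Y v = Im (p v)" for v
  have XY: "X v \<noteq> X w \<or> Y v \<noteq> Y w" if "v \<in> H" "w \<in> H" "v \<noteq> w" for v w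
    using that inj by (auto simp: X_def Y_def inj_on_def complex_eq_iff)
  note mem = v0(1) v1(1) v2(1) v3(1) v4(1) v5(1) v6(1) v7(1)
  note M0 = v0(2)[folded X_def Y_def, simplified] and M1 = v1(2)[folded X_def Y_def, simplified]
   and M2 = v2(2)[folded X_def Y_def, simplified] and M3 = v3(2)[folded X_def Y_def, simplified]
   and M4 = v4(2)[folded X_def Y_def, simplified] and M5 = v5(2)[folded X_def Y_def, simplified]
   and M6 = v6(2)[folded X_def Y_def, simplified] and M7 = v7(2)[folded X_def Y_def, simplified]
  \<comment> \<open>Comparing the maximality of consecutive vertices orders their coordinates, and
    \<open>XY\<close> makes the inequalities strict. The sides of the octagon alternate between an
    open quadrant and a cone of slope at most 1/2 around an axis; all chain orders below are linear
    consequences.\<close>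
  have s0: "X v1 < X v0 \<and> Y v1 > Y v0"
    using M0[OF mem(2)] M1[OF mem(1)] XY[OF mem(1) mem(2)] dist by auto
  have s1: "X v2 < X v1 \<and> 2 * (Y v2 - Y v1) \<le> X v1 - X v2 \<and> 2 * (Y v1 - Y v2) \<le> X v1 - X v2"
    using M1[OF mem(3)] M2[OF mem(2)] XY[OF mem(2) mem(3)] dist by auto
  have s2: "X v3 < X v2 \<and> Y v3 < Y v2"
    using M2[OF mem(4)] M3[OF mem(3)] XY[OF mem(3) mem(4)] dist by auto
  have s3: "Y v4 < Y v3 \<and> 2 * (X v4 - X v3) \<le> Y v3 - Y v4 \<and> 2 * (X v3 - X v4) \<le> Y v3 - Y v4"
    using M3[OF mem(5)] M4[OF mem(4)] XY[OF mem(4) mem(5)] dist by auto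
  have s4: "X v5 > X v4 \<and> Y v5 < Y v4"
    using M4[OF mem(6)] M5[OF mem(5)] XY[OF mem(5) mem(6)] dist by auto
  have s5: "X v6 > X v5 \<and> 2 * (Y v6 - Y v5) \<le> X v6 - X v5 \<and> 2 * (Y v5 - Y v6) \<le> X v6 - X v5"
    using M5[OF mem(7)] M6[OF mem(6)] XY[OF mem(6) mem(7)] dist by auto
  have s6: "X v7 > X v6 \<and> Y v7 > Y v6"
    using M6[OF mem(8)] M7[OF mem(7)] XY[OF mem(7) mem(8)] dist by auto
  have s7: "Y v0 > Y v7 \<and> 2 * (X v0 - X v7) \<le> Y v0 - Y v7 \<and> 2 * (X v7 - X v0) \<le> Y v0 - Y v7"
    using M7[OF mem(1)] M0[OF mem(8)] XY[OF mem(8) mem(1)] dist by auto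
  \<comment> \<open>\<open>f\<close> is constant in direction \<open>s\<close>. The edge leaving an
    \<open>a\<close> vertex through port \<open>s\<close> therefore keeps \<open>f\<close>, and
    since \<open>f\<close> is strictly monotone on the \<open>a\<close> chain, its other end lies in
    the \<open>b\<close> chain.\<close>
  have matched: "f a0 = f b0 \<and> f a1 = f b1 \<and> f a2 = f b2 \<and> f a3 = f b3"
    if f: "\<And>v. f v = c * X v + d * Y v" and cd: "c * fst s + d * snd s = 0" "s \<noteq> (0,0)"
      and A: "f a0 > f a1 \<and> f a1 > f a2 \<and> f a2 > f a3"
      and B: "f b0 > f b1 \<and> f b1 > f b2 \<and> f b2 > f b3"
      and s: "s \<in> \<sigma> a0" "s \<in> \<sigma> a1" "s \<in> \<sigma> a2" "s \<in> \<sigma> a3"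
      and ab: "H = {a0,a1,a2,a3,b0,b1,b2,b3}"
    for f :: "'v \<Rightarrow> real" and c d s a0 a1 a2 a3 b0 b1 b2 b3
  proof -
    have "\<forall>a\<in>{a0,a1,a2,a3}. f a \<in> {f b0, f b1, f b2, f b3}"
    proof
      fix a assume a: "a \<in> {a0,a1,a2,a3}"
      then have "s \<in> \<sigma> a" "a \<in> H" using s ab by auto
      then obtain w t where w: "w \<in> H" "t > 0" "X w = X a + fst s * t" "Y w = Y a + snd s * t"
        using nbr unfolding X_def Y_def by blast
      have "w \<noteq> a" using w cd(2) by (auto simp: prod_eq_iff)
      have "f w = f a + t * (c * fst s + d * snd s)" by (simp add: f w algebra_simps)
      then have "f w = f a" using cd(1) by simp
      then have "w \<notin> {a0,a1,a2,a3}" using a A \<open>w \<noteq> a\<close> by auto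
      then have "w \<in> {b0,b1,b2,b3}" using w(1) ab by auto
      then show "f a \<in> {f b0, f b1, f b2, f b3}" using \<open>f w = f a\<close> by auto
    qed
    then show ?thesis using A B by (intro four_chain_match) auto
  qed
  \<comment> \<open>In each of the four matchings the sum of the paired indices is constant modulo
    8: 7 for vertical edges, 3 for horizontal ones, 1 for slope -1 and 5 for slope 1. These are odd,
    so paired indices differ in parity.\<close>
  have xA: "X v0 > X v1 \<and> X v1 > X v2 \<and> X v2 > X v3"
    using s0 s1 s2 s3 s4 s5 s6 s7 by auto
  have xB: "X v7 > X v6 \<and> X v6 > X v5 \<and> X v5 > X v4"
    using s0 s1 s2 s3 s4 s5 s6 s7 by auto
  have xAB: "X v0 = X v7 \<and> X v1 = X v6 \<and> X v2 = X v5 \<and> X v3 = X v4"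
    by (rule matched[where f = "\<lambda>v. X v" and c = "1" and d = "0" and s = "(0,-1)"])
      (use xA xB in \<open>auto simp: H v0(3) v1(3) v2(3) v3(3) v4(3) v5(3) v6(3) v7(3)\<close>)
  have yA: "Y v1 > Y v0 \<and> Y v0 > Y v7 \<and> Y v7 > Y v6"
    using s0 s1 s2 s3 s4 s5 s6 s7 by auto
  have yB: "Y v2 > Y v3 \<and> Y v3 > Y v4 \<and> Y v4 > Y v5"
    using s0 s1 s2 s3 s4 s5 s6 s7 by auto
  have yAB: "Y v1 = Y v2 \<and> Y v0 = Y v3 \<and> Y v7 = Y v4 \<and> Y v6 = Y v5"
    by (rule matched[where f = "\<lambda>v. Y v" and c = "0" and d = "1" and s = "(-1,0)"])
      (use yA yB in \<open>auto simp: H v0(3) v1(3) v2(3) v3(3) v4(3) v5(3) v6(3) v7(3)\<close>)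
  have pA: "X v0 + Y v0 > X v7 + Y v7 \<and> X v7 + Y v7 > X v6 + Y v6 \<and> X v6 + Y v6 > X v5 + Y v5"
    using s0 s1 s2 s3 s4 s5 s6 s7 by auto
  have pB: "X v1 + Y v1 > X v2 + Y v2 \<and> X v2 + Y v2 > X v3 + Y v3 \<and> X v3 + Y v3 > X v4 + Y v4"
    using s0 s1 s2 s3 s4 s5 s6 s7 by auto
  have pAB: "X v0 + Y v0 = X v1 + Y v1 \<and> X v7 + Y v7 = X v2 + Y v2 \<and> X v6 + Y v6 = X v3 + Y v3 \<and> X v5 + Y v5 = X v4 + Y v4"
    by (rule matched[where f = "\<lambda>v. X v + Y v" and c = "1" and d = "1" and s = "(-1,1)"])
      (use pA pB in \<open>auto simp: H v0(3) v1(3) v2(3) v3(3) v4(3) v5(3) v6(3) v7(3)\<close>)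
  have qA: "X v7 - Y v7 > X v0 - Y v0 \<and> X v0 - Y v0 > X v1 - Y v1 \<and> X v1 - Y v1 > X v2 - Y v2"
    using s0 s1 s2 s3 s4 s5 s6 s7 by auto
  have qB: "X v6 - Y v6 > X v5 - Y v5 \<and> X v5 - Y v5 > X v4 - Y v4 \<and> X v4 - Y v4 > X v3 - Y v3"
    using s0 s1 s2 s3 s4 s5 s6 s7 by auto
  have qAB: "X v7 - Y v7 = X v6 - Y v6 \<and> X v0 - Y v0 = X v5 - Y v5 \<and> X v1 - Y v1 = X v4 - Y v4 \<and> X v2 - Y v2 = X v3 - Y v3"
    by (rule matched[where f = "\<lambda>v. X v - Y v" and c = "1" and d = "-1" and s = "(-1,-1)"])
      (use qA qB in \<open>auto simp: H v0(3) v1(3) v2(3) v3(3) v4(3) v5(3) v6(3) v7(3)\<close>)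
  \<comment> \<open>Each of the four functionals takes four values on \<open>H\<close>, each at one
    even and one odd index, so it is injective on either parity class.\<close>
  have "distinct (map (\<lambda>v. X v) [v0,v2,v4,v6])" "distinct (map (\<lambda>v. X v) [v1,v3,v5,v7])"
    using xA xB xAB by auto
  then have dX: "inj_on (\<lambda>v. X v) {v0,v2,v4,v6}" "inj_on (\<lambda>v. X v) {v1,v3,v5,v7}"
    by (simp_all only: distinct_map list.set)
  have "distinct (map (\<lambda>v. Y v) [v0,v2,v4,v6])" "distinct (map (\<lambda>v. Y v) [v1,v3,v5,v7])"
    using yA yB yAB by auto
  then have dY: "inj_on (\<lambda>v. Y v) {v0,v2,v4,v6}" "inj_on (\<lambda>v. Y v) {v1,v3,v5,v7}"
    by (simp_all only: distinct_map list.set)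
  have "distinct (map (\<lambda>v. X v + Y v) [v0,v2,v4,v6])" "distinct (map (\<lambda>v. X v + Y v) [v1,v3,v5,v7])"
    using pA pB pAB by auto
  then have dp: "inj_on (\<lambda>v. X v + Y v) {v0,v2,v4,v6}" "inj_on (\<lambda>v. X v + Y v) {v1,v3,v5,v7}"
    by (simp_all only: distinct_map list.set)
  have "distinct (map (\<lambda>v. X v - Y v) [v0,v2,v4,v6])" "distinct (map (\<lambda>v. X v - Y v) [v1,v3,v5,v7])"
    using qA qB qAB by auto
  then have dq: "inj_on (\<lambda>v. X v - Y v) {v0,v2,v4,v6}" "inj_on (\<lambda>v. X v - Y v) {v1,v3,v5,v7}"
    by (simp_all only: distinct_map list.set)
  \<comment> \<open>Two points on an octilinear line agree in one of \<open>X\<close>,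
    \<open>Y\<close>, \<open>X + Y\<close>, \<open>X - Y\<close>, which the injectivity above
    forbids within a parity class.\<close>
  have indep: "\<not> octilinear_vector (p w - p v)"
    if "v \<in> {v0,v2,v4,v6} \<and> w \<in> {v0,v2,v4,v6} \<or> v \<in> {v1,v3,v5,v7} \<and> w \<in> {v1,v3,v5,v7}" for v w
  proof
    assume oc: "octilinear_vector (p w - p v)"
    then have "v \<noteq> w" by (auto simp: octilinear_vector_def)
    moreover have "X v = X w \<or> Y v = Y w \<or> X v + Y v = X w + Y w \<or> X v - Y v = X w - Y w"
      using oc unfolding octilinear_vector_def X_def Y_def by auto
    ultimately show False
      using that dX dY dp dq unfolding inj_on_def by blast
  qed
  show ?thesis
  proof (intro exI[of _ "{v0,v2,v4,v6}"] ballI)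
    fix v w assume vw: "v \<in> H" "w \<in> N v"
    then have "w \<in> H" "octilinear_vector (p w - p v)" using N oct by blast+
    then show "v \<in> {v0,v2,v4,v6} \<longleftrightarrow> w \<notin> {v0,v2,v4,v6}"
      using indep[of v w] vw(1) dist unfolding H by auto
  qed
qed

section \<open>Bendless octilinear drawings of graphs\<close>

lemma start_dir_linepath: "start_dir (linepath a b) = sgn (b - a)"
  by (simp add: start_dir_def vector_derivative_linepath_within)

lemma end_dir_linepath: "end_dir (linepath a b) = sgn (b - a)"
  by (simp add: end_dir_def vector_derivative_linepath_within)

text \<open>A single segment runs straight between its two vertices. If it is traversed towards
  \<open>v\<close>, then \<open>port\<close> negates the end direction, which again points from
  \<open>v\<close> to \<open>w\<close>.\<close>

lemma bendless_octilinear_edge: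
  assumes dr: "planar_octilinear_drawing G pos segs" "bendless G segs"
    and G: "simple_graph G" and e: "{v, w} \<in> edges G"
  shows "octilinear_vector (pos w - pos v)" "port (segs {v, w}) (pos v) = sgn (pos w - pos v)"
proof -
  have vw: "v \<in> verts G" "w \<in> verts G" "v \<noteq> w"
    using G e by (fastforce simp: simple_graph_def)+
  have inj: "inj_on pos (verts G)"
    using dr by (simp add: planar_octilinear_drawing_def planar_drawing_def)
  then have ne: "pos v \<noteq> pos w" using vw by (auto simp: inj_on_def)
  have "length (segs {v, w}) = 1" "octilinear_edge (segs {v, w})"
    using dr e by (auto simp: bendless_def planar_octilinear_drawing_def)
  then obtain g where g: "segs {v, w} = [g]" "octilinear_segment g"
    by (auto simp: octilinear_edge_def length_Suc_conv)
  then obtain a b where ab: "g = linepath a b" "a \<noteq> b"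
      "Re a = Re b \<or> Im a = Im b \<or> \<bar>Re b - Re a\<bar> = \<bar>Im b - Im a\<bar>"
    by (auto simp: octilinear_segment_def)
  have "\<exists>x y. {v, w} = {x, y} \<and> pathstart (join_segments (segs {v, w})) = pos x \<and>
      pathfinish (join_segments (segs {v, w})) = pos y"
    using dr e by (auto simp: planar_octilinear_drawing_def planar_drawing_def)
  then have "a = pos v \<and> b = pos w \<or> a = pos w \<and> b = pos v"
    by (auto simp: g ab doubleton_eq_iff)
  then show "octilinear_vector (pos w - pos v)" "port (segs {v, w}) (pos v) = sgn (pos w - pos v)"
    using ab ne
    by (auto simp: octilinear_vector_def port_def g start_dir_linepath end_dir_linepath
        sgn_minus[symmetric] simp del: sgn_minus)
qed

text \<open>Closure under edges makes \<open>H\<close> a union of components, so \<open>H\<close>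
  with its neighbourhoods is bipartite, and a 2-colouring excludes a triangle.\<close>

lemma octilinear_small_component_no_triangle:
  assumes dr: "planar_octilinear_drawing G pos segs" "bendless G segs"
    and G: "simple_graph G" "regular_graph 4 G"
    and H: "H \<subseteq> verts G" "card H \<le> 8" "\<And>e. e \<in> edges G \<Longrightarrow> e \<inter> H \<noteq> {} \<Longrightarrow> e \<subseteq> H"
    and tri: "u \<in> H" "{u, v} \<in> edges G" "{v, w} \<in> edges G" "{u, w} \<in> edges G"
  shows False
proof -
  define N where "N x = {y. {x, y} \<in> edges G}" for x
  have inj: "inj_on pos H"
    using dr H(1) inj_on_subset by (auto simp: planar_octilinear_drawing_def planar_drawing_def)
  have NH: "N x \<subseteq> H" if "x \<in> H" for x
    using that H(3) by (fastforce simp: N_def)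
  have "\<exists>C. \<forall>x\<in>H. \<forall>y\<in>N x. x \<in> C \<longleftrightarrow> y \<notin> C"
  proof (rule small_octilinear_component_bipartite[where p = pos])
    show "finite H" using G(1) H(1) finite_subset by (auto simp: simple_graph_def)
    fix x assume x: "x \<in> H"
    let ?I = "{e \<in> edges G. x \<in> e}"
    have I: "?I = (\<lambda>y. {x, y}) ` N x"
    proof
      show "?I \<subseteq> (\<lambda>y. {x, y}) ` N x"
      proof clarify
        fix e assume e: "e \<in> edges G" "x \<in> e"
        then obtain y where "e = {x, y}"
          using G(1) by (fastforce simp: simple_graph_def card_2_iff)
        then show "e \<in> (\<lambda>y. {x, y}) ` N x" using e by (auto simp: N_def)
      qed
    qed (auto simp: N_def)
    \<comment> \<open>Injectivity of the ports turns degree 4 into four distinct unit vectors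
      towards the neighbours.\<close>
    have "card ((\<lambda>e. port (segs e) (pos x)) ` ?I) = card ?I"
      using dr(1) H(1) x
      by (intro card_image) (auto simp: planar_octilinear_drawing_def distinct_ports_def)
    also have "card ?I = 4" using G(2) H(1) x by (auto simp: regular_graph_def)
    also have "(\<lambda>e. port (segs e) (pos x)) ` ?I = (\<lambda>y. sgn (pos y - pos x)) ` N x"
      unfolding I image_image
      by (rule image_cong) (use bendless_octilinear_edge[OF dr G(1)] in \<open>auto simp: N_def\<close>)
    finally show "card ((\<lambda>y. sgn (pos y - pos x)) ` N x) = 4" .
  qed (use inj H tri NH bendless_octilinear_edge[OF dr G(1)] in \<open>auto simp: N_def\<close>)
  then obtain C where C: "\<And>x y. x \<in> H \<Longrightarrow> y \<in> N x \<Longrightarrow> x \<in> C \<longleftrightarrow> y \<notin> C" by blast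
  have "v \<in> H" using NH tri by (auto simp: N_def)
  then show False
    using C[of u v] C[of v w] C[of u w] tri by (auto simp: N_def)
qed

section \<open>A smooth orthogonal drawing of the square antiprism\<close>

text \<open>The argument of \<open>sgn\<close> is the derivative of
  \<open>part_circlepath c r s t\<close> at angle \<open>x\<close>. Its unit vector is the radial
  direction turned by a quarter, reversed on clockwise arcs.\<close>

lemma sgn_scaled_rotated_cis:
  assumes "r > 0"
  shows "sgn (\<i> * of_real r * (of_real t - of_real s) * cis x) = of_real (sgn (t - s)) * \<i> * cis x"
proof -
  have "\<i> * of_real r * (of_real t - of_real s) * cis x = of_real (r * (t - s)) * (\<i> * cis x)"
    by simp
  also have "sgn \<dots> = sgn (of_real (r * (t - s)) :: complex) * sgn (\<i> * cis x)"
    by (rule sgn_mult)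
  also have "sgn (of_real (r * (t - s)) :: complex) = of_real (sgn (t - s))"
    using assms by (simp add: sgn_of_real sgn_mult del: of_real_mult of_real_diff)
  also have "sgn (\<i> * cis x) = \<i> * cis x"
    by (simp add: sgn_eq norm_mult)
  finally show ?thesis by (simp add: mult.assoc)
qed

lemma start_dir_part_circlepath:
  assumes "r > 0"
  shows "start_dir (part_circlepath c r s t) = of_real (sgn (t - s)) * \<i> * cis s"
  using sgn_scaled_rotated_cis[OF assms, of t s s]
  by (simp add: start_dir_def vector_derivative_part_circlepath01 cis_conv_exp linepath_def)

lemma end_dir_part_circlepath:
  assumes "r > 0"
  shows "end_dir (part_circlepath c r s t) = of_real (sgn (t - s)) * \<i> * cis t"
  using sgn_scaled_rotated_cis[OF assms, of t s t]
  by (simp add: end_dir_def vector_derivative_part_circlepath01 cis_conv_exp linepath_def)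

text \<open>Only linear consequences of lying on the arc are recorded, so that comparing two edges is a
  matter of linear arithmetic.\<close>

definition quarter_region :: "real \<Rightarrow> real \<Rightarrow> bool" where
  "quarter_region a b \<longleftrightarrow> 0 \<le> a \<and> 0 \<le> b \<and> a \<le> 1 \<and> b \<le> 1 \<and> 1 \<le> a + b \<and>
     (a = 0 \<longrightarrow> b = 1) \<and> (b = 0 \<longrightarrow> a = 1) \<and> (a = 1 \<longrightarrow> b = 0) \<and> (b = 1 \<longrightarrow> a = 0)"

text \<open>Offsets from the centre for an arc of radius 2 that omits the open fourth quadrant.\<close>

definition three_quarter_region :: "real \<Rightarrow> real \<Rightarrow> bool" where
  "three_quarter_region a b \<longleftrightarrow> -2 \<le> a \<and> -2 \<le> b \<and> a \<le> 2 \<and> b \<le> 2 \<and> (a \<le> 0 \<or> 0 \<le> b) \<and>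
     (b = 0 \<and> 0 < a \<longrightarrow> a = 2) \<and> (a = 0 \<and> b < 0 \<longrightarrow> b = -2)"

text \<open>Numbers in [0, 1] dominate their squares, hence
  \<open>1 = a\<^sup>2 + b\<^sup>2 \<le> a + b\<close>: the arc lies beyond its chord.\<close>

lemma quarter_region_unit:
  assumes "a\<^sup>2 + b\<^sup>2 = 1" "0 \<le> a" "0 \<le> b"
  shows "quarter_region a b"
proof -
  have "a \<le> 1" "b \<le> 1"
    using assms by (smt (verit) power2_le_imp_le power_one zero_le_power2)+
  moreover have "a * a \<le> a" "b * b \<le> b"
    using assms calculation by (simp_all add: mult_left_le)
  ultimately show ?thesis
    using assms by (auto simp: quarter_region_def power2_eq_square)
qed

lemma quarter_region_cos_sin:
  assumes "0 \<le> x" "x \<le> pi / 2"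
  shows "quarter_region (cos x) (sin x)"
  using assms by (intro quarter_region_unit) (auto simp: cos_ge_zero sin_ge_zero)

text \<open>Up to angle pi the sine is nonnegative, and from there on the cosine is nonpositive, so
  the open fourth quadrant is avoided. On its two bounding half-axes the circle equation fixes the
  point.\<close>

lemma three_quarter_region_cos_sin:
  assumes "0 \<le> x" "x \<le> 3 * pi / 2"
  shows "three_quarter_region (2 * cos x) (2 * sin x)"
proof -
  have "cos x \<le> 0 \<or> 0 \<le> sin x"
  proof (cases "x \<le> pi")
    case True then show ?thesis using assms sin_ge_zero by auto
  next
    case False
    then have "0 \<le> cos (x - pi)" using assms by (intro cos_ge_zero) auto
    then show ?thesis by simp
  qed
  moreover have "cos x = 1" if "sin x = 0" "0 < cos x"
    using that sin_cos_squared_add[of x] by (simp add: power2_eq_1_iff)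
  moreover have "sin x = -1" if "cos x = 0" "sin x < 0"
    using that sin_cos_squared_add[of x] by (auto simp: power2_eq_1_iff)
  ultimately show ?thesis by (auto simp: three_quarter_region_def)
qed

text \<open>The vertices 0, 1, 2, 3 form the outer and 4, 5, 6, 7 the inner 4-cycle of the antiprism.\<close>

definition corner :: "nat \<Rightarrow> complex" where
  "corner i = [Complex 2 1, Complex 1 2, Complex (-1) 0, Complex 0 (-1),
     Complex 1 1, Complex 0 1, Complex 0 0, Complex 1 0] ! i"

text \<open>The outer 4-cycle, the inner 4-cycle, then the eight edges between them. Each pair is
  increasing, so it can be recovered from the edge as a set, and it fixes the direction of
  traversal.\<close>

definition antiprism_edges :: "(nat \<times> nat) list" where
  "antiprism_edges = [(0,1), (1,2), (2,3), (0,3), (4,5), (5,6), (6,7), (4,7),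
     (0,4), (0,7), (1,4), (1,5), (2,5), (2,6), (3,6), (3,7)]"

text \<open>Centre, radius, start angle and end angle; a decreasing angle means clockwise traversal.
  Edges not listed are straight.\<close>

definition circular_edges :: "nat \<times> nat \<rightharpoonup> complex \<times> real \<times> real \<times> real" where
  "circular_edges = map_of
     [((0,1), Complex 1 1, 1, 0, pi / 2), ((0,7), Complex 1 1, 1, 0, - (pi / 2)),
      ((1,5), Complex 1 1, 1, pi / 2, pi), ((2,5), Complex 0 0, 1, pi, pi / 2),
      ((2,3), Complex 0 0, 1, pi, 3 * pi / 2), ((3,7), Complex 0 0, 1, - (pi / 2), 0),
      ((0,3), Complex 2 (-1), 2, pi / 2, - pi), ((1,2), Complex (-1) 2, 2, 0, 3 * pi / 2)]"

definition antiprism_curve :: "complex \<Rightarrow> nat \<times> nat \<Rightarrow> real \<Rightarrow> complex" where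
  "antiprism_curve d e = (case circular_edges e of
     None \<Rightarrow> linepath (d + corner (fst e)) (d + corner (snd e))
   | Some (c, r, s, t) \<Rightarrow> part_circlepath (d + c) r s t)"

text \<open>A superset of the curve, in coordinates of the untranslated copy. The arguments reflect
  each arc about its centre into the standard position of the two region predicates.\<close>

definition edge_region :: "nat \<times> nat \<Rightarrow> real \<Rightarrow> real \<Rightarrow> bool" where
  "edge_region e x y \<longleftrightarrow> the (map_of
    [((0,1), quarter_region (x - 1) (y - 1)),
     ((0,7), quarter_region (x - 1) (1 - y)),
     ((1,5), quarter_region (1 - x) (y - 1)),
     ((2,5), quarter_region (- x) y),
     ((2,3), quarter_region (- x) (- y)),
     ((3,7), quarter_region x (- y)),
     ((1,2), three_quarter_region (x + 1) (y - 2)),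
     ((0,3), three_quarter_region (2 - x) (- 1 - y)),
     ((4,5), y = 1 \<and> 0 \<le> x \<and> x \<le> 1),
     ((5,6), x = 0 \<and> 0 \<le> y \<and> y \<le> 1),
     ((6,7), y = 0 \<and> 0 \<le> x \<and> x \<le> 1),
     ((4,7), x = 1 \<and> 0 \<le> y \<and> y \<le> 1),
     ((0,4), y = 1 \<and> 1 \<le> x \<and> x \<le> 2),
     ((1,4), x = 1 \<and> 1 \<le> y \<and> y \<le> 2),
     ((2,6), y = 0 \<and> - 1 \<le> x \<and> x \<le> 0),
     ((3,6), x = 0 \<and> - 1 \<le> y \<and> y \<le> 0)] e)"

text \<open>Unit tangents at the start and at the end, in the direction of traversal.\<close>

definition edge_dirs :: "nat \<times> nat \<Rightarrow> complex \<times> complex" where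
  "edge_dirs e = the (map_of
    [((0,1), \<i>, -1), ((0,7), -\<i>, -1), ((1,5), -1, -\<i>), ((2,5), \<i>, 1), ((2,3), -\<i>, 1),
     ((3,7), 1, \<i>), ((0,3), 1, \<i>), ((1,2), \<i>, 1),
     ((4,5), -1, -1), ((5,6), -\<i>, -\<i>), ((6,7), 1, 1), ((4,7), -\<i>, -\<i>),
     ((0,4), -1, -1), ((1,4), -\<i>, -\<i>), ((2,6), 1, 1), ((3,6), \<i>, \<i>)] e)"

section \<open>Pairwise intersections of the edge regions\<close>

lemma edge_region_simps:
  "edge_region (0,1) x y \<longleftrightarrow> quarter_region (x - 1) (y - 1)"
  "edge_region (0,7) x y \<longleftrightarrow> quarter_region (x - 1) (1 - y)"
  "edge_region (1,5) x y \<longleftrightarrow> quarter_region (1 - x) (y - 1)"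
  "edge_region (2,5) x y \<longleftrightarrow> quarter_region (- x) y"
  "edge_region (2,3) x y \<longleftrightarrow> quarter_region (- x) (- y)"
  "edge_region (3,7) x y \<longleftrightarrow> quarter_region x (- y)"
  "edge_region (1,2) x y \<longleftrightarrow> three_quarter_region (x + 1) (y - 2)"
  "edge_region (0,3) x y \<longleftrightarrow> three_quarter_region (2 - x) (- 1 - y)"
  "edge_region (4,5) x y \<longleftrightarrow> y = 1 \<and> 0 \<le> x \<and> x \<le> 1"
  "edge_region (5,6) x y \<longleftrightarrow> x = 0 \<and> 0 \<le> y \<and> y \<le> 1"
  "edge_region (6,7) x y \<longleftrightarrow> y = 0 \<and> 0 \<le> x \<and> x \<le> 1"
  "edge_region (4,7) x y \<longleftrightarrow> x = 1 \<and> 0 \<le> y \<and> y \<le> 1"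
  "edge_region (0,4) x y \<longleftrightarrow> y = 1 \<and> 1 \<le> x \<and> x \<le> 2"
  "edge_region (1,4) x y \<longleftrightarrow> x = 1 \<and> 1 \<le> y \<and> y \<le> 2"
  "edge_region (2,6) x y \<longleftrightarrow> y = 0 \<and> - 1 \<le> x \<and> x \<le> 0"
  "edge_region (3,6) x y \<longleftrightarrow> x = 0 \<and> - 1 \<le> y \<and> y \<le> 0"
  by (simp_all add: edge_region_def)

lemma corner_simps:
  "corner 0 = Complex 2 1" "corner 1 = Complex 1 2" "corner 2 = Complex (-1) 0" "corner 3 = Complex 0 (-1)"
  "corner 4 = Complex 1 1" "corner 5 = Complex 0 1" "corner 6 = Complex 0 0" "corner 7 = Complex 1 0"
  by (simp_all add: corner_def)

text \<open>By symmetry one order of each pair suffices, which leaves 120 comparisons for the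
  sixteen edges.\<close>

lemma sorted_wrt_symp_pairwise:
  "sorted_wrt P xs \<Longrightarrow> symp P \<Longrightarrow> a \<in> set xs \<Longrightarrow> b \<in> set xs \<Longrightarrow> a \<noteq> b \<Longrightarrow> P a b"
  by (induction xs) (auto dest: sympD)

definition edges_meet_at_corner :: "nat \<times> nat \<Rightarrow> nat \<times> nat \<Rightarrow> bool" where
  "edges_meet_at_corner a b \<longleftrightarrow> (\<forall>x y. edge_region a x y \<longrightarrow> edge_region b x y \<longrightarrow>
     (\<exists>i\<in>set [fst a, snd a]. i \<in> set [fst b, snd b] \<and> Complex x y = corner i))"


text \<open>The quarter regions lie in different unit squares of the integer grid and the straight
  edges on grid lines, so they meet only on grid lines, where the implications in
  \<open>quarter_region\<close> leave just the ends of the arc. The three-quarter regions meet the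
  square \<open>[-1,2]\<close> x \<open>[-1,2]\<close> containing all these edges only on its
  boundary, and they are disjoint from each other. Each pair is a Boolean combination of linear
  constraints.\<close>

lemma antiprism_edges_meet_at_corner: "sorted_wrt edges_meet_at_corner antiprism_edges"
  unfolding antiprism_edges_def sorted_wrt.simps list.set ball_simps
  by (intro conjI TrueI; unfold edges_meet_at_corner_def; simp add: corner_simps del: One_nat_def;
     unfold edge_region_simps quarter_region_def three_quarter_region_def; intro allI; argo)

lemma antiprism_edges_bound: "e \<in> set antiprism_edges \<Longrightarrow> fst e < snd e \<and> snd e < 8"
  by (auto simp: antiprism_edges_def)

lemma corner_eq_iff: "i < 8 \<Longrightarrow> j < 8 \<Longrightarrow> corner i = corner j \<longleftrightarrow> i = j"
  unfolding corner_def by (subst nth_eq_iff_index_eq) auto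

lemma cis_quarter_turns:
  "cis (pi / 2) = \<i>" "cis (- (pi / 2)) = - \<i>" "cis (3 * pi / 2) = - \<i>" "cis (- pi) = -1"
proof -
  have "cis (3 * pi / 2) = cis pi * cis (pi / 2)" by (subst cis_mult) (simp add: field_simps)
  then show "cis (3 * pi / 2) = - \<i>" by simp
qed (auto simp: complex_eq_iff)

lemma pathstart_part_circlepath_cis: "pathstart (part_circlepath z r s t) = z + r * cis s"
  by (simp add: cis_conv_exp)

lemma pathfinish_part_circlepath_cis: "pathfinish (part_circlepath z r s t) = z + r * cis t"
  by (simp add: cis_conv_exp)

lemma circular_edges_simps:
  "circular_edges (0,1) = Some (Complex 1 1, 1, 0, pi / 2)"
  "circular_edges (0,7) = Some (Complex 1 1, 1, 0, - (pi / 2))"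
  "circular_edges (1,5) = Some (Complex 1 1, 1, pi / 2, pi)"
  "circular_edges (2,5) = Some (Complex 0 0, 1, pi, pi / 2)"
  "circular_edges (2,3) = Some (Complex 0 0, 1, pi, 3 * pi / 2)"
  "circular_edges (3,7) = Some (Complex 0 0, 1, - (pi / 2), 0)"
  "circular_edges (0,3) = Some (Complex 2 (-1), 2, pi / 2, - pi)"
  "circular_edges (1,2) = Some (Complex (-1) 2, 2, 0, 3 * pi / 2)"
  "circular_edges (4,5) = None" "circular_edges (5,6) = None" "circular_edges (6,7) = None"
  "circular_edges (4,7) = None" "circular_edges (0,4) = None" "circular_edges (1,4) = None"
  "circular_edges (2,6) = None" "circular_edges (3,6) = None"
  by (simp_all add: circular_edges_def)

lemma edge_dirs_simps:
  "edge_dirs (0,1) = (\<i>, -1)" "edge_dirs (0,7) = (-\<i>, -1)" "edge_dirs (1,5) = (-1, -\<i>)"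
  "edge_dirs (2,5) = (\<i>, 1)" "edge_dirs (2,3) = (-\<i>, 1)" "edge_dirs (3,7) = (1, \<i>)"
  "edge_dirs (0,3) = (1, \<i>)" "edge_dirs (1,2) = (\<i>, 1)" "edge_dirs (4,5) = (-1, -1)"
  "edge_dirs (5,6) = (-\<i>, -\<i>)" "edge_dirs (6,7) = (1, 1)" "edge_dirs (4,7) = (-\<i>, -\<i>)"
  "edge_dirs (0,4) = (-1, -1)" "edge_dirs (1,4) = (-\<i>, -\<i>)" "edge_dirs (2,6) = (1, 1)"
  "edge_dirs (3,6) = (\<i>, \<i>)"
  by (simp_all add: edge_dirs_def)

text \<open>Case rule over concrete pairs, on which the tables above can be evaluated.\<close>

lemma ball_antiprism_edges:
  assumes "P (0,1)" "P (1,2)" "P (2,3)" "P (0,3)" "P (4,5)" "P (5,6)" "P (6,7)" "P (4,7)"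
    "P (0,4)" "P (0,7)" "P (1,4)" "P (1,5)" "P (2,5)" "P (2,6)" "P (3,6)" "P (3,7)" "e \<in> set antiprism_edges"
  shows "P e"
  using assms by (auto simp: antiprism_edges_def)

section \<open>The sixteen curves\<close>

lemma antiprism_curve_ends:
  assumes "e \<in> set antiprism_edges"
  shows "pathstart (antiprism_curve d e) = d + corner (fst e) \<and>
    pathfinish (antiprism_curve d e) = d + corner (snd e)"
  by (rule ball_antiprism_edges[OF _ _ _ _ _ _ _ _ _ _ _ _ _ _ _ _ assms])
    (simp_all add: antiprism_curve_def circular_edges_simps corner_simps cis_quarter_turns
      pathstart_part_circlepath_cis pathfinish_part_circlepath_cis complex_eq_iff
      del: One_nat_def pathstart_part_circlepath pathfinish_part_circlepath)

lemma antiprism_curve_dirs: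
  assumes "e \<in> set antiprism_edges"
  shows "start_dir (antiprism_curve d e) = fst (edge_dirs e) \<and>
    end_dir (antiprism_curve d e) = snd (edge_dirs e)"
  by (rule ball_antiprism_edges[OF _ _ _ _ _ _ _ _ _ _ _ _ _ _ _ _ assms])
    (simp_all add: antiprism_curve_def circular_edges_simps corner_simps edge_dirs_simps cis_quarter_turns
      start_dir_linepath end_dir_linepath start_dir_part_circlepath end_dir_part_circlepath
      sgn_eq complex_eq_iff cmod_def del: One_nat_def)

lemma antiprism_curve_arc:
  assumes "e \<in> set antiprism_edges"
  shows "arc (antiprism_curve d e)"
  by (rule ball_antiprism_edges[OF _ _ _ _ _ _ _ _ _ _ _ _ _ _ _ _ assms])
    (auto simp: antiprism_curve_def circular_edges_simps corner_simps complex_eq_iff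
      intro!: arc_linepath arc_part_circlepath simp del: One_nat_def)

lemma edge_dirs_axis:
  assumes "e \<in> set antiprism_edges"
  shows "fst (edge_dirs e) \<in> axis_dirs \<and> snd (edge_dirs e) \<in> axis_dirs"
  by (rule ball_antiprism_edges[OF _ _ _ _ _ _ _ _ _ _ _ _ _ _ _ _ assms])
    (simp_all add: edge_dirs_simps axis_dirs_def del: One_nat_def)

lemma antiprism_curve_segment:
  assumes "e \<in> set antiprism_edges"
  shows "axis_line_segment (antiprism_curve d e) \<or> axis_circular_segment (antiprism_curve d e)"
proof (cases "circular_edges e")
  case None
  have "circular_edges e = None \<longrightarrow> Re (corner (fst e)) = Re (corner (snd e)) \<or> Im (corner (fst e)) = Im (corner (snd e))"
    by (rule ball_antiprism_edges[OF _ _ _ _ _ _ _ _ _ _ _ _ _ _ _ _ assms])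
      (simp_all add: circular_edges_simps corner_simps del: One_nat_def)
  moreover have "corner (fst e) \<noteq> corner (snd e)"
    using antiprism_edges_bound[OF assms] by (simp add: corner_eq_iff)
  ultimately have "axis_line_segment (antiprism_curve d e)"
    unfolding axis_line_segment_def antiprism_curve_def None
    by (intro exI[of _ "d + corner (fst e)"] exI[of _ "d + corner (snd e)"]) (use None in auto)
  then show ?thesis ..
next
  case (Some q)
  obtain c r s t where q: "q = (c, r, s, t)" by (cases q)
  have "case circular_edges e of None \<Rightarrow> True | Some (c, r, s, t) \<Rightarrow> r > 0 \<and> \<bar>t - s\<bar> \<in> {pi / 2, pi, 3 * pi / 2}"
    by (rule ball_antiprism_edges[OF _ _ _ _ _ _ _ _ _ _ _ _ _ _ _ _ assms])
      (simp_all add: circular_edges_simps del: One_nat_def)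
  then have "r > 0 \<and> \<bar>t - s\<bar> \<in> {pi / 2, pi, 3 * pi / 2}" "antiprism_curve d e = part_circlepath (d + c) r s t"
    by (simp_all add: Some q antiprism_curve_def)
  then have "axis_circular_segment (antiprism_curve d e)"
    unfolding axis_circular_segment_def
    using antiprism_curve_dirs[OF assms, of d] edge_dirs_axis[OF assms] by auto
  then show ?thesis ..
qed

text \<open>For a point at angle x on a circular edge, replacing x by -x, pi - x, x - pi or x + pi
  where necessary moves the angle interval to [0, pi/2] or [0, 3pi/2]. These substitutions
  correspond to the reflections in \<open>edge_region\<close>.\<close>

lemma antiprism_curve_region:
  assumes "e \<in> set antiprism_edges" "z \<in> path_image (antiprism_curve d e)"
  shows "edge_region e (Re (z - d)) (Im (z - d))"
proof -
  have Q: "quarter_region (cos x) (sin x)" if "x \<in> {0..pi/2}" for x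
    using that quarter_region_cos_sin by auto
  have T: "three_quarter_region (2 * cos x) (2 * sin x)" if "x \<in> {0..3 * pi/2}" for x
    using that three_quarter_region_cos_sin by auto
  have "\<forall>z\<in>path_image (antiprism_curve d e). edge_region e (Re (z - d)) (Im (z - d))"
  proof (rule ball_antiprism_edges[OF _ _ _ _ _ _ _ _ _ _ _ _ _ _ _ _ assms(1)])
    show "\<forall>z\<in>path_image (antiprism_curve d (0,1)). edge_region (0,1) (Re (z - d)) (Im (z - d))"
      using Q by (auto simp: antiprism_curve_def circular_edges_simps path_image_part_circlepath'
          closed_segment_eq_real_ivl edge_region_simps simp del: One_nat_def)
    show "\<forall>z\<in>path_image (antiprism_curve d (0,7)). edge_region (0,7) (Re (z - d)) (Im (z - d))"
      using Q[of "- x" for x] by (auto simp: antiprism_curve_def circular_edges_simps path_image_part_circlepath'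
          closed_segment_eq_real_ivl edge_region_simps simp del: One_nat_def)
    show "\<forall>z\<in>path_image (antiprism_curve d (1,5)). edge_region (1,5) (Re (z - d)) (Im (z - d))"
      using Q[of "pi - x" for x] by (auto simp: antiprism_curve_def circular_edges_simps path_image_part_circlepath'
          closed_segment_eq_real_ivl edge_region_simps simp del: One_nat_def)
    show "\<forall>z\<in>path_image (antiprism_curve d (2,5)). edge_region (2,5) (Re (z - d)) (Im (z - d))"
      using Q[of "pi - x" for x] by (auto simp: antiprism_curve_def circular_edges_simps path_image_part_circlepath'
          closed_segment_eq_real_ivl edge_region_simps simp del: One_nat_def)
    show "\<forall>z\<in>path_image (antiprism_curve d (2,3)). edge_region (2,3) (Re (z - d)) (Im (z - d))"
      using Q[of "x - pi" for x] by (auto simp: antiprism_curve_def circular_edges_simps path_image_part_circlepath'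
          closed_segment_eq_real_ivl edge_region_simps simp del: One_nat_def)
    show "\<forall>z\<in>path_image (antiprism_curve d (3,7)). edge_region (3,7) (Re (z - d)) (Im (z - d))"
      using Q[of "- x" for x] by (auto simp: antiprism_curve_def circular_edges_simps path_image_part_circlepath'
          closed_segment_eq_real_ivl edge_region_simps simp del: One_nat_def)
    show "\<forall>z\<in>path_image (antiprism_curve d (1,2)). edge_region (1,2) (Re (z - d)) (Im (z - d))"
      using T by (auto simp: antiprism_curve_def circular_edges_simps path_image_part_circlepath'
          closed_segment_eq_real_ivl edge_region_simps simp del: One_nat_def)
    show "\<forall>z\<in>path_image (antiprism_curve d (0,3)). edge_region (0,3) (Re (z - d)) (Im (z - d))"
      using T[of "x + pi" for x] by (auto simp: antiprism_curve_def circular_edges_simps path_image_part_circlepath'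
          closed_segment_eq_real_ivl edge_region_simps simp del: One_nat_def)
  qed (auto simp: antiprism_curve_def circular_edges_simps corner_simps edge_region_simps
      closed_segment_same_Re closed_segment_same_Im closed_segment_eq_real_ivl simp del: One_nat_def split: if_splits)
  then show ?thesis using assms(2) by blast
qed

text \<open>The drawing has width at most 7, so copies shifted by multiples of 10 do not
  interfere.\<close>

lemma edge_region_bound:
  assumes "e \<in> set antiprism_edges" "edge_region e x y"
  shows "-3 \<le> x \<and> x \<le> 4"
proof -
  have "edge_region e x y \<longrightarrow> -3 \<le> x \<and> x \<le> 4"
    by (rule ball_antiprism_edges[OF _ _ _ _ _ _ _ _ _ _ _ _ _ _ _ _ assms(1)]; 
      unfold edge_region_simps quarter_region_def three_quarter_region_def; argo)
  then show ?thesis using assms(2) by blast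
qed

section \<open>Disjoint unions of antiprisms\<close>

text \<open>Vertex \<open>8 * c + i\<close> is vertex \<open>i\<close> of copy \<open>c\<close>, so
  division by 8 with remainder recovers both.\<close>

definition antiprism_edge :: "nat \<Rightarrow> nat \<times> nat \<Rightarrow> nat set" where
  "antiprism_edge c a = {8 * c + fst a, 8 * c + snd a}"

definition antiprisms :: "nat \<Rightarrow> nat graph" where
  "antiprisms n = \<lparr>verts = {..<8 * n},
     edges = {antiprism_edge c a | c a. c < n \<and> a \<in> set antiprism_edges}\<rparr>"

definition offset :: "nat \<Rightarrow> complex" where
  "offset c = of_real (10 * real c)"

definition antiprisms_pos :: "nat \<Rightarrow> complex" where
  "antiprisms_pos v = offset (v div 8) + corner (v mod 8)"

text \<open>An edge is an unordered set; as the listed pairs increase, \<open>Min\<close> and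
  \<open>Max\<close> give back the pair and with it the orientation of the curve.\<close>

definition antiprisms_segs :: "nat set \<Rightarrow> (real \<Rightarrow> complex) list" where
  "antiprisms_segs e =
     [antiprism_curve (offset (Min e div 8)) (Min e mod 8, Max e mod 8)]"

lemma edges_antiprisms:
  "edges (antiprisms n) = {antiprism_edge c a | c a. c < n \<and> a \<in> set antiprism_edges}"
  by (simp add: antiprisms_def)

lemma antiprism_edge_in_edges:
  "c < n \<Longrightarrow> a \<in> set antiprism_edges \<Longrightarrow> antiprism_edge c a \<in> edges (antiprisms n)"
  by (auto simp only: edges_antiprisms)

lemma antiprisms_segs_edge:
  assumes "a \<in> set antiprism_edges"
  shows "antiprisms_segs (antiprism_edge c a) = [antiprism_curve (offset c) a]"
  using antiprism_edges_bound[OF assms]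
  by (simp add: antiprisms_segs_def antiprism_edge_def max_def min_def prod_eq_iff)

lemma antiprisms_pos_shift: "i < 8 \<Longrightarrow> antiprisms_pos (8 * c + i) = offset c + corner i"
  by (simp add: antiprisms_pos_def)

lemma corner_bounds: "i < 8 \<Longrightarrow> -1 \<le> Re (corner i) \<and> Re (corner i) \<le> 2"
proof -
  assume "i < 8"
  then have "i \<in> {0,1,2,3,4,5,6,7}" by auto
  then show ?thesis by (auto simp: corner_simps simp del: One_nat_def)
qed

text \<open>Corners of one copy differ by at most 3 in the real part, while copies are 10 apart:
  equal positions force equal copies and then equal corners.\<close>

lemma inj_antiprisms_pos: "inj antiprisms_pos"
proof (rule injI)
  fix v w assume eq: "antiprisms_pos v = antiprisms_pos w"
  have b: "-1 \<le> Re (corner (v mod 8)) \<and> Re (corner (v mod 8)) \<le> 2"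
    "-1 \<le> Re (corner (w mod 8)) \<and> Re (corner (w mod 8)) \<le> 2"
    using corner_bounds by simp_all
  have "10 * real (v div 8) + Re (corner (v mod 8)) = 10 * real (w div 8) + Re (corner (w mod 8))"
    using arg_cong[OF eq, of Re] by (simp add: antiprisms_pos_def offset_def)
  then have "real (v div 8) < real (w div 8) + 1" "real (w div 8) < real (v div 8) + 1"
    using b by linarith+
  then have dv: "v div 8 = w div 8" by linarith
  then have "corner (v mod 8) = corner (w mod 8)" using eq by (simp add: antiprisms_pos_def)
  then have "v mod 8 = w mod 8" by (simp add: corner_eq_iff)
  with dv show "v = w" by (metis mult_div_mod_eq)
qed

section \<open>Simplicity and regularity\<close>

lemma simple_antiprisms: "simple_graph (antiprisms n)"
proof -
  have "e \<subseteq> {..<8 * n} \<and> card e = 2" if "e \<in> edges (antiprisms n)" for e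
    using that antiprism_edges_bound unfolding edges_antiprisms antiprism_edge_def
    by (fastforce simp: card_2_iff)
  then show ?thesis by (simp add: simple_graph_def antiprisms_def)
qed

text \<open>Reduces statements about degrees and ports to finite checks on a single
  antiprism.\<close>

lemma incident_antiprisms:
  assumes "c < n" "i < 8"
  shows "{e \<in> edges (antiprisms n). 8 * c + i \<in> e} =
    antiprism_edge c ` {a \<in> set antiprism_edges. i \<in> {fst a, snd a}}" (is "?L = ?R")
proof
  show "?L \<subseteq> ?R"
  proof clarify
    fix e assume e: "e \<in> edges (antiprisms n)" "8 * c + i \<in> e"
    then obtain c' a where a: "a \<in> set antiprism_edges" "e = antiprism_edge c' a"
      by (auto simp: edges_antiprisms)
    then obtain j where j: "j \<in> {fst a, snd a}" "8 * c + i = 8 * c' + j"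
      using e(2) by (auto simp: antiprism_edge_def)
    then have "j < 8" using antiprism_edges_bound[OF a(1)] by auto
    then have "c = c'" "i = j"
      using assms(2) arg_cong[OF j(2), of "\<lambda>k. k div 8"] arg_cong[OF j(2), of "\<lambda>k. k mod 8"] by simp_all
    then show "e \<in> ?R" using a j(1) by blast
  qed
  have "antiprism_edge c a \<in> ?L" if "a \<in> set antiprism_edges" "i \<in> {fst a, snd a}" for a
    using that(2) antiprism_edge_in_edges[OF assms(1) that(1)] unfolding antiprism_edge_def by blast
  then show "?R \<subseteq> ?L" by blast
qed

lemma inj_antiprism_edge: "inj_on (antiprism_edge c) (set antiprism_edges)"
proof (rule inj_onI)
  fix a b assume "a \<in> set antiprism_edges" "b \<in> set antiprism_edges" "antiprism_edge c a = antiprism_edge c b"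
  then show "a = b"
    using antiprism_edges_bound[of a] antiprism_edges_bound[of b]
    by (auto simp: antiprism_edge_def doubleton_eq_iff prod_eq_iff)
qed

lemma regular_antiprisms: "regular_graph 4 (antiprisms n)"
proof -
  have "card {e \<in> edges (antiprisms n). v \<in> e} = 4" if v: "v < 8 * n" for v
  proof -
    define i c where "i = v mod 8" and "c = v div 8"
    have ci: "v = 8 * c + i" "i < 8" "c < n" using v by (auto simp: i_def c_def)
    have "card {e \<in> edges (antiprisms n). v \<in> e} = card {a \<in> set antiprism_edges. i \<in> {fst a, snd a}}"
      unfolding ci(1) incident_antiprisms[OF ci(3,2)]
      by (rule card_image) (rule inj_on_subset[OF inj_antiprism_edge], auto)
    also have "\<dots> = card (set (filter (\<lambda>a. i = fst a \<or> i = snd a) antiprism_edges))"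
      by (simp add: Collect_conj_eq Int_commute)
    also have "\<dots> = 4"
    proof -
      have "i \<in> {0,1,2,3,4,5,6,7}" using ci(2) by auto
      then show ?thesis by (auto simp: antiprism_edges_def)
    qed
    finally show ?thesis .
  qed
  then show ?thesis by (auto simp: regular_graph_def antiprisms_def)
qed

section \<open>The smooth orthogonal drawing\<close>

text \<open>The bounds on the real part put both curves into the same copy, where the pairwise
  comparison of regions applies.\<close>

lemma antiprisms_curves_meet:
  assumes a: "a \<in> set antiprism_edges" "a' \<in> set antiprism_edges"
    and ne: "antiprism_edge c a \<noteq> antiprism_edge c' a'"
    and z: "z \<in> path_image (antiprism_curve (offset c) a)"
      "z \<in> path_image (antiprism_curve (offset c') a')"
  shows "z \<in> antiprisms_pos ` (antiprism_edge c a \<inter> antiprism_edge c' a')"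
proof -
  have r: "edge_region a (Re (z - offset c)) (Im (z - offset c))" "edge_region a' (Re (z - offset c')) (Im (z - offset c'))"
    using antiprism_curve_region a z by blast+
  have "-3 \<le> Re z - 10 * real c" "Re z - 10 * real c \<le> 4" "-3 \<le> Re z - 10 * real c'" "Re z - 10 * real c' \<le> 4"
    using edge_region_bound[OF a(1) r(1)] edge_region_bound[OF a(2) r(2)] by (auto simp: offset_def)
  then have "real c < real c' + 1" "real c' < real c + 1" by linarith+
  then have c: "c' = c" by linarith
  have "symp edges_meet_at_corner"
    unfolding edges_meet_at_corner_def symp_def by blast
  moreover have "a \<noteq> a'" using ne c by auto
  ultimately have "edges_meet_at_corner a a'"
    using sorted_wrt_symp_pairwise[OF antiprism_edges_meet_at_corner] a by blast
  then obtain i where i: "i \<in> {fst a, snd a}" "i \<in> {fst a', snd a'}" "z - offset c = corner i"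
    using r unfolding edges_meet_at_corner_def c by (force simp: complex_eq_iff)
  have "i < 8" using i(1) antiprism_edges_bound[OF a(1)] by auto
  then have "z = antiprisms_pos (8 * c + i)" using i(3) antiprisms_pos_shift[of i c] by (simp add: diff_eq_eq add.commute)
  then show ?thesis using i(1,2) by (auto simp: antiprism_edge_def c)
qed

lemma antiprisms_curve_ends:
  assumes "a \<in> set antiprism_edges"
  shows "pathstart (antiprism_curve (offset c) a) = antiprisms_pos (8 * c + fst a)"
    "pathfinish (antiprism_curve (offset c) a) = antiprisms_pos (8 * c + snd a)"
  using antiprism_curve_ends[OF assms, of "offset c"] antiprism_edges_bound[OF assms]
  by (simp_all add: antiprisms_pos_shift)

lemma antiprisms_pos_in_curve:
  assumes "a \<in> set antiprism_edges" "v \<in> antiprism_edge c a"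
  shows "antiprisms_pos v \<in> path_image (antiprism_curve (offset c) a)"
  using assms(2) antiprisms_curve_ends[OF assms(1), of c]
    pathstart_in_path_image[of "antiprism_curve (offset c) a"]
    pathfinish_in_path_image[of "antiprism_curve (offset c) a"]
  by (auto simp: antiprism_edge_def)

lemma planar_drawing_antiprisms:
  "planar_drawing (antiprisms n) antiprisms_pos (\<lambda>e. join_segments (antiprisms_segs e))"
proof -
  let ?\<gamma> = "\<lambda>e. join_segments (antiprisms_segs e)"
  have meet: "path_image (?\<gamma> e) \<inter> path_image (?\<gamma> e') = antiprisms_pos ` (e \<inter> e')"
    if "e \<in> edges (antiprisms n)" "e' \<in> edges (antiprisms n)" "e \<noteq> e'" for e e'
  proof -
    obtain c a where a: "a \<in> set antiprism_edges" "e = antiprism_edge c a"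
      using \<open>e \<in> _\<close> by (auto simp: edges_antiprisms)
    obtain c' a' where a': "a' \<in> set antiprism_edges" "e' = antiprism_edge c' a'"
      using \<open>e' \<in> _\<close> by (auto simp: edges_antiprisms)
    show ?thesis
      unfolding a(2) a'(2) antiprisms_segs_edge[OF a(1)] antiprisms_segs_edge[OF a'(1)] join_segments.simps
    proof (intro equalityI subsetI)
      fix z assume "z \<in> path_image (antiprism_curve (offset c) a) \<inter> path_image (antiprism_curve (offset c') a')"
      then show "z \<in> antiprisms_pos ` (antiprism_edge c a \<inter> antiprism_edge c' a')"
        using antiprisms_curves_meet[OF a(1) a'(1)] \<open>e \<noteq> e'\<close> a(2) a'(2) by simp
    next
      fix z assume "z \<in> antiprisms_pos ` (antiprism_edge c a \<inter> antiprism_edge c' a')"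
      then obtain v where "z = antiprisms_pos v" "v \<in> antiprism_edge c a" "v \<in> antiprism_edge c' a'" by blast
      then show "z \<in> path_image (antiprism_curve (offset c) a) \<inter> path_image (antiprism_curve (offset c') a')"
        using antiprisms_pos_in_curve a(1) a'(1) by simp
    qed
  qed
  \<comment> \<open>As \<open>v\<close> has degree 4, it is an end of some edge \<open>e'\<close>.
    If it lay on \<open>e\<close> without being an end of \<open>e\<close>, then \<open>e\<close>
    and \<open>e'\<close> would meet outside their common ends.\<close>
  have vert: "v \<in> e" if e: "e \<in> edges (antiprisms n)" and v: "v \<in> verts (antiprisms n)"
    and p: "antiprisms_pos v \<in> path_image (?\<gamma> e)" for e v
  proof (rule ccontr)
    assume "v \<notin> e"
    have "card {e \<in> edges (antiprisms n). v \<in> e} = 4"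
      using regular_antiprisms v by (auto simp: regular_graph_def)
    then have "{e \<in> edges (antiprisms n). v \<in> e} \<noteq> {}" by (metis card.empty zero_neq_numeral)
    then obtain e' where e': "e' \<in> edges (antiprisms n)" "v \<in> e'" by blast
    then obtain c a where "a \<in> set antiprism_edges" "e' = antiprism_edge c a"
      by (auto simp: edges_antiprisms)
    then have "antiprisms_pos v \<in> path_image (?\<gamma> e')"
      using antiprisms_pos_in_curve e'(2) by (simp add: antiprisms_segs_edge)
    then have "antiprisms_pos v \<in> antiprisms_pos ` (e \<inter> e')"
      using meet[OF e e'(1)] p e'(2) \<open>v \<notin> e\<close> by blast
    then show False using inj_antiprisms_pos \<open>v \<notin> e\<close> by (auto dest: injD)
  qed
  have arc: "arc (?\<gamma> e) \<and> (\<exists>u v. e = {u, v} \<and> pathstart (?\<gamma> e) = antiprisms_pos u \<and>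
      pathfinish (?\<gamma> e) = antiprisms_pos v)" if e: "e \<in> edges (antiprisms n)" for e
  proof -
    obtain c a where a: "a \<in> set antiprism_edges" "e = antiprism_edge c a"
      using e by (auto simp: edges_antiprisms)
    show ?thesis
      unfolding a(2) antiprisms_segs_edge[OF a(1)] join_segments.simps
      using antiprism_curve_arc[OF a(1)] antiprisms_curve_ends[OF a(1), of c] antiprism_edge_def by blast
  qed
  show ?thesis
    unfolding planar_drawing_def
  proof (intro conjI ballI impI)
    show "inj_on antiprisms_pos (verts (antiprisms n))"
      by (rule inj_on_subset[OF inj_antiprisms_pos]) simp
  qed (simp_all add: arc vert meet)
qed

text \<open>The function gives the port at corner \<open>i\<close>: the start direction of an
  outgoing edge, the reversed end direction of an incoming one.\<close>

lemma inj_edge_dirs_at_corner: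
  assumes "i < 8"
  shows "inj_on (\<lambda>a. if fst a = i then fst (edge_dirs a) else - snd (edge_dirs a))
    {a \<in> set antiprism_edges. i \<in> {fst a, snd a}}"
proof -
  let ?f = "\<lambda>a. if fst a = i then fst (edge_dirs a) else - snd (edge_dirs a)"
  have "i \<in> {0,1,2,3,4,5,6,7}" using assms by auto
  then have "distinct (map ?f (filter (\<lambda>a. i = fst a \<or> i = snd a) antiprism_edges))"
    by (elim insertE emptyE; simp add: antiprism_edges_def edge_dirs_simps complex_eq_iff del: One_nat_def)
  then have "inj_on ?f (set (filter (\<lambda>a. i = fst a \<or> i = snd a) antiprism_edges))"
    by (simp only: distinct_map)
  then show ?thesis by (rule inj_on_subset) auto
qed

lemma distinct_ports_antiprisms: "distinct_ports (antiprisms n) antiprisms_pos antiprisms_segs"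
  unfolding distinct_ports_def
proof
  fix v assume "v \<in> verts (antiprisms n)"
  then have v: "v < 8 * n" by (simp add: antiprisms_def)
  define i c where "i = v mod 8" and "c = v div 8"
  have ci: "v = 8 * c + i" "i < 8" "c < n" using v by (auto simp: i_def c_def)
  let ?A = "{a \<in> set antiprism_edges. i \<in> {fst a, snd a}}"
  let ?p = "\<lambda>e. port (antiprisms_segs e) (antiprisms_pos v)"
  have "?p (antiprism_edge c a) = (if fst a = i then fst (edge_dirs a) else - snd (edge_dirs a))"
    if "a \<in> ?A" for a
  proof -
    have a: "a \<in> set antiprism_edges" using that by simp
    \<comment> \<open>Injectivity of the positions makes the test in \<open>port\<close> decide
      whether the edge starts at \<open>v\<close>.\<close>
    have "antiprisms_pos (8 * c + fst a) = antiprisms_pos v \<longleftrightarrow> fst a = i"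
      unfolding ci(1) using inj_antiprisms_pos by (auto dest: injD)
    then show ?thesis
      by (simp add: port_def antiprisms_segs_edge[OF a] antiprisms_curve_ends[OF a]
          antiprism_curve_dirs[OF a])
  qed
  then have "inj_on (?p \<circ> antiprism_edge c) ?A"
    using inj_edge_dirs_at_corner[OF ci(2)]
    by (subst inj_on_cong[where
          g = "\<lambda>a. if fst a = i then fst (edge_dirs a) else - snd (edge_dirs a)"]) auto
  then show "inj_on ?p {e \<in> edges (antiprisms n). v \<in> e}"
    unfolding ci(1) incident_antiprisms[OF ci(3,2)] by (rule inj_on_imageI)
qed

lemma smooth_orthogonal_antiprisms:
  "planar_smooth_orthogonal_drawing (antiprisms n) antiprisms_pos antiprisms_segs"
  unfolding planar_smooth_orthogonal_drawing_def
proof (intro conjI ballI planar_drawing_antiprisms distinct_ports_antiprisms)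
  fix e assume "e \<in> edges (antiprisms n)"
  then obtain c a where a: "a \<in> set antiprism_edges" "e = antiprism_edge c a"
    by (auto simp: edges_antiprisms)
  then show "smooth_orthogonal_edge (antiprisms_segs e)"
    using antiprism_curve_segment[OF a(1)] by (simp add: antiprisms_segs_edge smooth_orthogonal_edge_def)
qed

text \<open>The first copy is closed under edges, has eight vertices and contains the triangle 0, 1,
  4.\<close>

lemma no_octilinear_antiprisms:
  assumes "n > 0"
  shows "\<not> (\<exists>pos segs. planar_octilinear_drawing (antiprisms n) pos segs \<and> bendless (antiprisms n) segs)"
proof clarify
  fix pos segs
  assume dr: "planar_octilinear_drawing (antiprisms n) pos segs" "bendless (antiprisms n) segs"
  have tri: "(0,1) \<in> set antiprism_edges" "(1,4) \<in> set antiprism_edges" "(0,4) \<in> set antiprism_edges"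
    by (auto simp: antiprism_edges_def)
  have e: "{fst a, snd a} \<in> edges (antiprisms n)" if "a \<in> set antiprism_edges" for a
    using antiprism_edge_in_edges[OF assms that] by (simp add: antiprism_edge_def)
  show False
  proof (rule octilinear_small_component_no_triangle[OF dr simple_antiprisms regular_antiprisms, of "{..<8}" 0 1 4])
    show "{..<8} \<subseteq> verts (antiprisms n)" using assms by (auto simp: antiprisms_def)
    show "e \<subseteq> {..<8}" if ed: "e \<in> edges (antiprisms n)" "e \<inter> {..<8} \<noteq> {}" for e
    proof -
      obtain c a where a: "a \<in> set antiprism_edges" "e = antiprism_edge c a"
        using ed(1) by (auto simp: edges_antiprisms)
      then have "c = 0" using ed(2) by (auto simp: antiprism_edge_def)
      then show ?thesis using a antiprism_edges_bound[OF a(1)] by (auto simp: antiprism_edge_def)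
    qed
  qed (use e[OF tri(1)] e[OF tri(2)] e[OF tri(3)] in auto)
qed

theorem theorem2:
  shows "\<exists>\<F> :: nat graph set.
    infinite \<F> \<and> pairwise (\<lambda>G H. \<not> isomorphic G H) \<F> \<and>
    (\<forall>G\<in>\<F>. simple_graph G \<and> regular_graph 4 G \<and> planar_graph G \<and>
       (\<exists>pos segs. planar_smooth_orthogonal_drawing G pos segs \<and> bendless G segs) \<and>
       \<not> (\<exists>pos segs. planar_octilinear_drawing G pos segs \<and> bendless G segs))"
proof (intro exI[of _ "range (\<lambda>n. antiprisms (Suc n))"] conjI ballI)
  \<comment> \<open>\<open>Suc n\<close> leaves out the empty graph, which is trivially
    drawable.\<close>
  let ?F = "range (\<lambda>n. antiprisms (Suc n))"
  \<comment> \<open>The number of vertices, \<open>8 * n\<close>, is an isomorphism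
    invariant.\<close>
  have iso: "m = n" if "isomorphic (antiprisms m) (antiprisms n)" for m n
    using that by (auto simp: isomorphic_def antiprisms_def dest: bij_betw_same_card)
  have "inj (\<lambda>n. antiprisms (Suc n))"
  proof (rule injI)
    fix m n assume "antiprisms (Suc m) = antiprisms (Suc n)"
    then have "card (verts (antiprisms (Suc m))) = card (verts (antiprisms (Suc n)))" by simp
    then show "m = n" by (simp add: antiprisms_def)
  qed
  then show "infinite ?F" by (rule range_inj_infinite)
  show "pairwise (\<lambda>G H. \<not> isomorphic G H) ?F"
    using iso by (auto simp: pairwise_def)
  fix G assume "G \<in> ?F"
  then obtain n where G: "G = antiprisms (Suc n)" by auto
  show "simple_graph G" "regular_graph 4 G"
    by (simp_all add: G simple_antiprisms regular_antiprisms)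
  show "planar_graph G"
    unfolding G planar_graph_def using planar_drawing_antiprisms by blast
  have "bendless G antiprisms_segs" by (simp add: bendless_def antiprisms_segs_def)
  then show "\<exists>pos segs. planar_smooth_orthogonal_drawing G pos segs \<and> bendless G segs"
    using smooth_orthogonal_antiprisms G by blast
  show "\<not> (\<exists>pos segs. planar_octilinear_drawing G pos segs \<and> bendless G segs)"
    unfolding G by (rule no_octilinear_antiprisms) simp
qed

end
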